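(* Let $X$ be a Banach space with a shrinking finite-dimensional decomposition $(E_n)_{n=1}^\infty$. Suppose that $Z$ is a Banach space with $X^*\subseteq Z$ as sets, and that for some constants $0<C_1,C_2<\infty$ we have $$C_1\|x^*\|_Z\leq\|x^*\|_{X^*}\leq C_2\|x^*\|_Z\quad\text{for each } x^*\in X^*.$$ Assume that $\varphi,\psi,\chi\colon[0,\infty)\to[0,\infty)$ are continuous bijections such that for each $x^*\in X^*$ and all sufficiently large $n\in\mathbb{N}$, we have $$\varphi(\|P_n(x^* )\|_Z)+\psi(\|(I-P_n)(x^* )\|_Z)\leq\chi(\|x^*\|_Z),$$ where $P_n\colon X^*\to X^*$ is the canonical projection onto $\mathrm{span}\bigcup_{j\leq n}E_j^*$. Then, for every $\varepsilon\in(0,2)$, we have $$R_X(\varepsilon)\leq C_2\,\varphi^{-1}\Big(\chi\Big(\frac{1}{C_1}\Big)-\psi\Big(\frac{\varepsilon}{2C_2}\Big)\Big).$$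
   Context: For a weak$^*$-compact set $K\subset X^*$ and $\varepsilon\in(0,2)$, the $\varepsilon$-Szlenk derivation of $K$ is $$s_\varepsilon K=\{x^*\in K\colon \mathrm{diam}(K\cap V)>\varepsilon\text{ for every weak}^*\text{-open neighborhood }V\text{ of }x^*\},$$ where the diameter is taken with respect to the norm of $X^*$. $B_{X^*}$ denotes the closed unit ball of $X^*$, and $$R_X(\varepsilon)=\inf\{R>0\colon s_\varepsilon B_{X^*}\subseteq R B_{X^*}\}.$$ A sequence $(E_n)_{n=1}^\infty$ of finite-dimensional subspaces of $X$ is a finite-dimensional decomposition (FDD) of $X$ if for every $x\in X$ there is a unique sequence $(x_n)$ with $x_n\in E_n$ for each $n$ and $x=\sum_{n=1}^\infty x_n$. Let $Q_n\colon X\to X$ be the partial sum projection $Q_n(\sum_{i=1}^\infty x_i)=\sum_{i=1}^n x_i$ (where $x_i\in E_i$). The space $E_n^*$ is identified with the subspace of $X^*$ consisting of the functionals vanishing on $E_j$ for all $j\neq n$, and it carries the norm inherited from $X^*$. The FDD is shrinking if the norm closure in $X^*$ of the linear span of $\bigcup_n E_n^*$ is all of $X^*$; in this case $(E_n^* )_{n=1}^\infty$ is an FDD of $X^*$. The canonical projection $P_n$ is the $n$-th partial sum projection of $(E_n^* )$, i.e. $P_n=Q_n^*$. $I$ is the identity on $X^*$.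
   Formalization: "Sufficiently large n" is taken uniformly in x* (with n depending on x* the claim fails, e.g. in l_2); for finite-dimensional X the bound is stated only when the argument of φ^{-1} is nonnegative (proved for infinite-dimensional X); scalars are real. *)

theory Defs
  imports "HOL-Analysis.Analysis"
begin

text \<open>The dual of a real Banach space \<open>'a\<close> is the type \<open>'a \<Rightarrow>\<^sub>L real\<close> with the operator norm. For
  scalar-valued operators the topology of pointwise convergence is the weak* topology.\<close>

abbreviation weak_star_topology :: "('a::real_normed_vector \<Rightarrow>\<^sub>L real) topology" where
  "weak_star_topology \<equiv> strong_operator_topology"

text \<open>The derivation is meant for weak*-compact \<open>K\<close>. If \<open>'a\<close> is a Banach space, such \<open>K\<close> are
  norm-bounded, so that the real-valued \<^const>\<open>diameter\<close> is the genuine one.\<close>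

definition szlenk_derivation ::
    "real \<Rightarrow> ('a::real_normed_vector \<Rightarrow>\<^sub>L real) set \<Rightarrow> ('a \<Rightarrow>\<^sub>L real) set" where
  "szlenk_derivation \<epsilon> K =
    {f \<in> K. \<forall>V. openin weak_star_topology V \<and> f \<in> V \<longrightarrow> \<epsilon> < diameter (K \<inter> V)}"

definition szlenk_radius :: "'a::real_normed_vector itself \<Rightarrow> real \<Rightarrow> real" where
  "szlenk_radius X \<epsilon> =
    Inf {R. 0 < R \<and> szlenk_derivation \<epsilon> (cball (0 :: 'a \<Rightarrow>\<^sub>L real) 1) \<subseteq> cball 0 R}"

definition finite_dim_subspace :: "'a::real_vector set \<Rightarrow> bool" where
  "finite_dim_subspace S \<longleftrightarrow> (\<exists>B. finite B \<and> S = span B)"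

text \<open>The summands are indexed from 0: \<open>E n\<close> is the \<open>(n + 1)\<close>-st subspace of the decomposition, and
  the \<open>n\<close>-th partial sum projection is onto \<open>E 0 + \<dots> + E (n - 1)\<close>, the first \<open>n\<close> summands. Summands
  may be trivial, so finite-dimensional spaces are included.\<close>

definition fdd :: "(nat \<Rightarrow> 'a::real_normed_vector set) \<Rightarrow> bool" where
  "fdd E \<longleftrightarrow> (\<forall>n. finite_dim_subspace (E n)) \<and>
    (\<forall>x. \<exists>!c. (\<forall>n. c n \<in> E n) \<and> c sums x)"

definition fdd_expansion :: "(nat \<Rightarrow> 'a::real_normed_vector set) \<Rightarrow> 'a \<Rightarrow> nat \<Rightarrow> 'a" where
  "fdd_expansion E x = (THE c. (\<forall>n. c n \<in> E n) \<and> c sums x)"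

definition fdd_partial_sum :: "(nat \<Rightarrow> 'a::real_normed_vector set) \<Rightarrow> nat \<Rightarrow> 'a \<Rightarrow> 'a" where
  "fdd_partial_sum E n x = (\<Sum>i<n. fdd_expansion E x i)"

definition fdd_dual :: "(nat \<Rightarrow> 'a::real_normed_vector set) \<Rightarrow> nat \<Rightarrow> ('a \<Rightarrow>\<^sub>L real) set" where
  "fdd_dual E n = {f. \<forall>j. j \<noteq> n \<longrightarrow> (\<forall>x\<in>E j. blinfun_apply f x = 0)}"

definition shrinking_fdd :: "(nat \<Rightarrow> 'a::real_normed_vector set) \<Rightarrow> bool" where
  "shrinking_fdd E \<longleftrightarrow> fdd E \<and> closure (span (\<Union>n. fdd_dual E n)) = UNIV"

text \<open>The adjoint of the \<open>n\<close>-th partial sum projection. The conversion by \<^const>\<open>Blinfun\<close> is meaningful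
  because the partial sum projections of an FDD of a Banach space are bounded.\<close>

definition fdd_dual_proj ::
    "(nat \<Rightarrow> 'a::real_normed_vector set) \<Rightarrow> nat \<Rightarrow> ('a \<Rightarrow>\<^sub>L real) \<Rightarrow> ('a \<Rightarrow>\<^sub>L real)" where
  "fdd_dual_proj E n f = f o\<^sub>L Blinfun (fdd_partial_sum E n)"

end

theory Submission
  imports Defs
begin

text \<open>Let \<open>f\<close> lie in the \<open>\<epsilon>\<close>-derivation of the dual ball. Since \<open>P\<^sub>n f \<longlonglongrightarrow> f\<close> and \<open>P\<^sub>n\<close> depends on
  finitely many evaluations only, for large \<open>n\<close> a small weak* neighbourhood of \<open>f\<close> contains \<open>g\<close> in
  the ball with \<open>\<parallel>g - f\<parallel> > \<epsilon> / 2\<close>, \<open>P\<^sub>n g \<approx> f\<close> and hence \<open>\<parallel>(I - P\<^sub>n) g\<parallel>\<close> at least almost \<open>\<epsilon> / 2\<close>.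
  The renorming inequality at \<open>g\<close> gives \<open>\<phi>(\<parallel>f\<parallel> / C\<^sub>2) + \<psi>(\<epsilon> / (2 C\<^sub>2)) \<le> \<chi>(1 / C\<^sub>1)\<close> in the limit.
  In infinite dimension the argument of \<open>\<phi>\<^sup>-\<^sup>1\<close> is nonnegative, by the renorming inequality at a norm-one
  functional killed by \<open>P\<^sub>n\<close>.\<close>

section \<open>Finite-dimensional subspaces of normed spaces\<close>

text \<open>Dividing by \<open>t\<close> shows that \<open>b - x / t\<close> lies in
  \<open>F\<close>, at distance \<open>norm x / \<bar>t\<bar>\<close> from \<open>b\<close>. So the
  \<open>b\<close>-coordinate modulo a closed subspace is continuous, with constant
  \<open>1 / infdist b F\<close>.\<close>

lemma coordinate_bound:
  fixes b :: "'a::real_normed_vector"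
  assumes F: "closed F" "subspace F" and b: "b \<notin> F" and v: "x - t *\<^sub>R b \<in> F"
  shows "\<bar>t\<bar> * infdist b F \<le> norm x"
proof (cases "t = 0")
  case False
  have "- (1 / t) *\<^sub>R (x - t *\<^sub>R b) \<in> F"
    using F(2) v by (rule subspace_scale)
  then have "infdist b F \<le> dist b (- (1 / t) *\<^sub>R (x - t *\<^sub>R b))"
    by (rule infdist_le)
  also have "\<dots> = norm ((1 / t) *\<^sub>R x)"
    using False by (simp add: dist_norm algebra_simps)
  finally show ?thesis
    using False by (simp add: field_simps)
qed simp

lemma infdist_subspace_pos:
  fixes b :: "'a::real_normed_vector"
  assumes "closed F" "subspace F" "b \<notin> F"
  shows "0 < infdist b F"
  using assms infdist_pos_not_in_closed subspace_0 by blast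

text \<open>Along a convergent sequence the coefficients of \<open>b\<close> are Cauchy by
  \<open>coordinate_bound\<close>; subtracting their limit reduces the claim to the closed span of
  \<open>B\<close>.\<close>

lemma closed_span_insert:
  fixes b :: "'a::real_normed_vector"
  assumes cl: "closed (span B)"
  shows "closed (span (insert b B))"
proof (cases "b \<in> span B")
  case True
  then show ?thesis using cl by (simp add: span_redundant)
next
  case False
  let ?d = "infdist b (span B)"
  have d: "0 < ?d"
    using cl False by (simp add: infdist_subspace_pos)
  have bound: "\<bar>t\<bar> * ?d \<le> norm x" if "x - t *\<^sub>R b \<in> span B" for x t
    using coordinate_bound[OF cl subspace_span False that] .
  show ?thesis
    unfolding closed_sequential_limits
  proof (intro allI impI, elim conjE)
    fix X l assume X: "\<forall>n. X n \<in> span (insert b B)" and l: "X \<longlonglongrightarrow> l"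
    from X obtain t where t: "\<And>n. X n - t n *\<^sub>R b \<in> span B"
      by (simp only: span_breakdown_eq) metis
    have "Cauchy t"
      unfolding Cauchy_iff
    proof (intro allI impI)
      fix e :: real assume "0 < e"
      then have "0 < e * ?d" using d by simp
      moreover have "Cauchy X" using l by (rule LIMSEQ_imp_Cauchy)
      ultimately obtain M where M: "\<And>m n. m \<ge> M \<Longrightarrow> n \<ge> M \<Longrightarrow> norm (X m - X n) < e * ?d"
        unfolding Cauchy_iff by meson
      have "norm (t m - t n) < e" if "m \<ge> M" "n \<ge> M" for m n
      proof -
        have "(X m - X n) - (t m - t n) *\<^sub>R b \<in> span B"
          using span_diff[OF t[of m] t[of n]] by (simp add: algebra_simps)
        then have "\<bar>t m - t n\<bar> * ?d < e * ?d"
          using bound M[OF that] by fastforce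
        then show ?thesis using d by simp
      qed
      then show "\<exists>M. \<forall>m\<ge>M. \<forall>n\<ge>M. norm (t m - t n) < e" by blast
    qed
    then obtain s where "t \<longlonglongrightarrow> s"
      using Cauchy_convergent_iff convergent_def by blast
    then have "(\<lambda>n. X n - t n *\<^sub>R b) \<longlonglongrightarrow> l - s *\<^sub>R b"
      using l by (intro tendsto_intros)
    then have "l - s *\<^sub>R b \<in> span B"
      by (rule closed_sequentially[OF cl t])
    then show "l \<in> span (insert b B)"
      by (auto simp: span_breakdown_eq)
  qed
qed

lemma closed_span_finite:
  fixes B :: "'a::real_normed_vector set"
  assumes "finite B"
  shows "closed (span B)"
  using assms by (induction B) (auto intro: closed_span_insert)

text \<open>Turns finitely many evaluations into a norm estimate. It matters that \<open>K\<close>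
  is independent of \<open>h\<close>: this is what makes a weak* neighbourhood small in norm after
  projecting.\<close>

lemma functional_bound_on_span:
  fixes B :: "'a::real_normed_vector set"
  assumes "finite B"
  shows "\<exists>K\<ge>0. \<forall>(h :: 'a \<Rightarrow>\<^sub>L real). \<forall>x\<in>span B. \<bar>h x\<bar> \<le> K * norm x * (\<Sum>b\<in>B. \<bar>h b\<bar>)"
  using assms
proof (induction B)
  case empty
  then show ?case by (auto intro: exI[of _ 0])
next
  case (insert b B)
  then obtain K where K: "K \<ge> 0"
    and IH: "\<And>(h :: 'a \<Rightarrow>\<^sub>L real) x. x \<in> span B \<Longrightarrow> \<bar>h x\<bar> \<le> K * norm x * (\<Sum>b\<in>B. \<bar>h b\<bar>)"
    by blast
  have cl: "closed (span B)" using insert.hyps by (simp add: closed_span_finite)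
  show ?case
  proof (cases "b \<in> span B")
    case True
    have "\<bar>h x\<bar> \<le> K * norm x * (\<Sum>b\<in>insert b B. \<bar>h b\<bar>)"
      if "x \<in> span (insert b B)" for h :: "'a \<Rightarrow>\<^sub>L real" and x
    proof -
      have "\<bar>h x\<bar> \<le> K * norm x * (\<Sum>b\<in>B. \<bar>h b\<bar>)"
        using that True by (intro IH) (simp add: span_redundant)
      also have "\<dots> \<le> K * norm x * (\<Sum>b\<in>insert b B. \<bar>h b\<bar>)"
        using insert.hyps K by (intro mult_left_mono) auto
      finally show ?thesis .
    qed
    then show ?thesis using K by blast
  next
    case False
    define d where "d = infdist b (span B)"
    have d: "0 < d"
      unfolding d_def using cl False by (simp add: infdist_subspace_pos)
    \<comment> \<open>The first summand pays for the component in \<open>span B\<close>, whose norm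
      is at most \<open>(1 + norm b / d) * norm x\<close>; the second pays for the coefficient of
      \<open>b\<close>.\<close>
    define L where "L = K * (1 + norm b / d) + 1 / d"
    have "L \<ge> 0" using K d by (simp add: L_def)
    moreover have "\<bar>h x\<bar> \<le> L * norm x * (\<Sum>b\<in>insert b B. \<bar>h b\<bar>)"
      if x: "x \<in> span (insert b B)" for h :: "'a \<Rightarrow>\<^sub>L real" and x
    proof -
      obtain t where t: "x - t *\<^sub>R b \<in> span B"
        using x by (auto simp: span_breakdown_eq)
      define S where "S = (\<Sum>b\<in>B. \<bar>h b\<bar>)"
      have S: "S \<ge> 0" by (simp add: S_def sum_nonneg)
      have tb: "\<bar>t\<bar> \<le> norm x / d"
        using coordinate_bound[OF cl subspace_span False t] d by (simp add: d_def field_simps)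
      have nv: "norm (x - t *\<^sub>R b) \<le> (1 + norm b / d) * norm x"
      proof -
        have "norm (x - t *\<^sub>R b) \<le> norm x + \<bar>t\<bar> * norm b"
          by (metis norm_scaleR norm_triangle_ineq4)
        also have "\<dots> \<le> norm x + norm x / d * norm b"
          using tb by (intro add_left_mono mult_right_mono) auto
        finally show ?thesis by (simp add: algebra_simps)
      qed
      have "h x = h (x - t *\<^sub>R b) + t * h b"
        by (simp add: blinfun.diff_right blinfun.scaleR_right)
      then have "\<bar>h x\<bar> \<le> \<bar>h (x - t *\<^sub>R b)\<bar> + \<bar>t\<bar> * \<bar>h b\<bar>"
        by (metis abs_mult abs_triangle_ineq)
      also have "\<dots> \<le> K * norm (x - t *\<^sub>R b) * S + norm x / d * \<bar>h b\<bar>"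
        unfolding S_def by (intro add_mono IH[OF t] mult_right_mono tb) auto
      also have "\<dots> \<le> K * ((1 + norm b / d) * norm x) * S + norm x / d * \<bar>h b\<bar>"
        using nv K S by (intro add_right_mono mult_right_mono mult_left_mono) auto
      also have "\<dots> \<le> L * norm x * S + L * norm x * \<bar>h b\<bar>"
      proof (intro add_mono)
        show "K * ((1 + norm b / d) * norm x) * S \<le> L * norm x * S"
          using d S K by (intro mult_right_mono) (auto simp: L_def algebra_simps)
        have "1 / d \<le> L"
          using K d by (simp add: L_def)
        then have "1 / d * (norm x * \<bar>h b\<bar>) \<le> L * (norm x * \<bar>h b\<bar>)"
          by (intro mult_right_mono) auto
        then show "norm x / d * \<bar>h b\<bar> \<le> L * norm x * \<bar>h b\<bar>"
          by (simp add: algebra_simps)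
      qed
      also have "\<dots> = L * norm x * (\<Sum>b\<in>insert b B. \<bar>h b\<bar>)"
        using insert.hyps by (simp add: S_def algebra_simps)
      finally show ?thesis .
    qed
    ultimately show ?thesis by blast
  qed
qed

text \<open>The functional is the coordinate of a new generator modulo the closed span of the
  earlier ones; \<open>coordinate_bound\<close> makes it well defined and continuous. Linearity on
  the span suffices, since it is later composed with an FDD coordinate map.\<close>

lemma exists_nonzero_functional_on_span:
  fixes B :: "'a::real_normed_vector set"
  assumes "finite B" "\<not> span B \<subseteq> {0}"
  shows "\<exists>c b. b \<in> span B \<and> c b \<noteq> (0::real) \<and> (\<exists>K. \<forall>x\<in>span B. \<bar>c x\<bar> \<le> K * norm x) \<and>
    (\<forall>x\<in>span B. \<forall>y\<in>span B. c (x + y) = c x + c y) \<and> (\<forall>r. \<forall>x\<in>span B. c (r *\<^sub>R x) = r * c x)"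
  using assms
proof (induction B)
  case (insert b B)
  show ?case
  proof (cases "b \<in> span B")
    case True
    then show ?thesis using insert by (simp add: span_redundant)
  next
    case False
    let ?F = "span B"
    have cl: "closed ?F" using insert.hyps by (simp add: closed_span_finite)
    define c where "c x = (THE t. x - t *\<^sub>R b \<in> ?F)" for x
    have c: "c x = t" if "x - t *\<^sub>R b \<in> ?F" for x t
      unfolding c_def
    proof (rule the_equality[where P = "\<lambda>t. x - t *\<^sub>R b \<in> ?F"])
      fix s assume "x - s *\<^sub>R b \<in> ?F"
      with that have "(x - t *\<^sub>R b) - (x - s *\<^sub>R b) \<in> ?F" by (rule span_diff)
      \<comment> \<open>Written as a decomposition of the zero vector, so that
        \<open>coordinate_bound\<close> forces \<open>t - s\<close> to vanish.\<close>
      then have "0 - (t - s) *\<^sub>R b \<in> ?F" by (simp add: algebra_simps)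
      then have "\<bar>t - s\<bar> * infdist b ?F \<le> norm (0::'a)"
        by (rule coordinate_bound[OF cl subspace_span False])
      moreover have "0 < infdist b ?F"
        using cl False by (simp add: infdist_subspace_pos)
      ultimately show "s = t"
        by (simp add: mult_le_0_iff)
    qed fact
    have mem: "x - c x *\<^sub>R b \<in> ?F" if "x \<in> span (insert b B)" for x
      using that c by (auto simp: span_breakdown_eq)
    show ?thesis
    proof (intro exI conjI ballI allI)
      show "b \<in> span (insert b B)" by (simp add: span_base)
      have "c b = 1" by (rule c) (simp add: span_zero)
      then show "c b \<noteq> 0" by simp
      fix x assume x: "x \<in> span (insert b B)"
      show "\<bar>c x\<bar> \<le> 1 / infdist b ?F * norm x"
        using coordinate_bound[OF cl subspace_span False mem[OF x]]
          infdist_subspace_pos[OF cl subspace_span False] by (simp add: field_simps)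
      show "c (x + y) = c x + c y" if "y \<in> span (insert b B)" for y
        using span_add[OF mem[OF x] mem[OF that]] by (intro c) (simp add: algebra_simps)
      show "c (r *\<^sub>R x) = r * c x" for r
        using span_scale[OF mem[OF x], of r] by (intro c) (simp add: algebra_simps)
    qed
  qed
qed simp

section \<open>Boundedness of the partial sum projections\<close>

text \<open>Baire category: a countable union of closed sets with empty interior has empty
  interior.\<close>

lemma countable_closed_cover_interior:
  fixes F :: "nat \<Rightarrow> 'a::banach set"
  assumes cl: "\<And>k. closed (F k)" and cover: "(\<Union>k. F k) = UNIV"
  shows "\<exists>k. interior (F k) \<noteq> {}"
proof (rule ccontr)
  assume "\<not> ?thesis"
  then have int: "interior (F k) = {}" for k by blast
  have "Met_TC.mcomplete TYPE('a)"
    by (simp add: complete_UNIV)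
  then have "Met_TC.mtopology interior_of \<Union>(range F) = {}"
    by (rule Met_TC.metric_Baire_category_alt) (use cl int in auto)
  then show False
    using cover by simp
qed

section \<open>Uniqueness and linearity of FDD expansions\<close>

lemma fdd_summand:
  assumes "fdd E"
  shows "closed (E n)" "subspace (E n)"
  using assms closed_span_finite subspace_span
  unfolding fdd_def finite_dim_subspace_def by metis+

lemma fdd_expansion:
  assumes "fdd E"
  shows "fdd_expansion E x n \<in> E n" and "fdd_expansion E x sums x"
proof -
  have "\<exists>!c. (\<forall>n. c n \<in> E n) \<and> c sums x"
    using assms by (simp add: fdd_def)
  from theI'[OF this] show "fdd_expansion E x n \<in> E n" "fdd_expansion E x sums x"
    by (auto simp: fdd_expansion_def)
qed

lemma fdd_expansion_unique:
  assumes "fdd E" "\<And>n. c n \<in> E n" "c sums x"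
  shows "fdd_expansion E x = c"
proof -
  have "\<exists>!c. (\<forall>n. c n \<in> E n) \<and> c sums x"
    using assms by (simp add: fdd_def)
  then show ?thesis
    using assms(2,3) fdd_expansion[OF assms(1), of x] by blast
qed

lemma fdd_expansion_add:
  assumes "fdd E"
  shows "fdd_expansion E (x + y) = (\<lambda>n. fdd_expansion E x n + fdd_expansion E y n)"
  using assms fdd_summand[OF assms] fdd_expansion[OF assms]
  by (intro fdd_expansion_unique) (auto intro: sums_add subspace_add)

lemma fdd_expansion_scaleR:
  assumes "fdd E"
  shows "fdd_expansion E (r *\<^sub>R x) = (\<lambda>n. r *\<^sub>R fdd_expansion E x n)"
  using assms fdd_summand[OF assms] fdd_expansion[OF assms]
  by (intro fdd_expansion_unique) (auto intro: sums_scaleR_right subspace_scale)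

lemma linear_fdd_partial_sum:
  assumes "fdd E"
  shows "linear (fdd_partial_sum E n)"
proof (rule linearI)
  show "fdd_partial_sum E n (x + y) = fdd_partial_sum E n x + fdd_partial_sum E n y" for x y
    by (simp add: fdd_partial_sum_def fdd_expansion_add[OF assms] sum.distrib)
  show "fdd_partial_sum E n (r *\<^sub>R x) = r *\<^sub>R fdd_partial_sum E n x" for r x
    by (simp add: fdd_partial_sum_def fdd_expansion_scaleR[OF assms] scaleR_sum_right)
qed

lemma fdd_partial_sum_LIMSEQ:
  assumes "fdd E"
  shows "(\<lambda>n. fdd_partial_sum E n x) \<longlonglongrightarrow> x"
  using fdd_expansion(2)[OF assms, of x] by (simp add: fdd_partial_sum_def sums_def)

text \<open>The next three lemmas are the proof of the open mapping theorem, run for the norm \<open>sup\<^sub>n \<parallel>Q\<^sub>n x\<parallel>\<close> without introducing a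
  second normed space: by Baire, every vector is approximated by vectors with controlled partial
  sums, and a geometric series of such approximations sums to \<open>x\<close> expansion by expansion.\<close>

lemma fdd_partial_sum_bound_of_series:
  fixes E :: "nat \<Rightarrow> 'a::banach set"
  assumes E: "fdd E" and a: "a sums x"
    and g: "\<And>n j. norm (fdd_partial_sum E n (a j)) \<le> g j" and sg: "summable g"
  shows "norm (fdd_partial_sum E n x) \<le> suminf g"
proof -
  let ?Q = "fdd_partial_sum E" and ?c = "fdd_expansion E"
  have c_eq: "?c y i = ?Q (Suc i) y - ?Q i y" for y i
    by (simp add: fdd_partial_sum_def)
  have summ: "summable (\<lambda>j. ?Q n (a j))" for n
    using g by (intro summable_comparison_test[OF _ sg]) auto
  \<comment> \<open>The candidate expansion of \<open>x\<close>: sum the \<open>i\<close>-th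
    coordinates of the pieces \<open>a j\<close>. Each coordinate is a difference of two partial
    sums, hence summable.\<close>
  define y where "y i = (\<Sum>j. ?c (a j) i)" for i
  have summc: "summable (\<lambda>j. ?c (a j) i)" for i
    unfolding c_eq by (intro summable_diff summ)
  have S: "(\<Sum>i<n. y i) = (\<Sum>j. ?Q n (a j))" for n
    unfolding y_def fdd_partial_sum_def using summc by (simp add: suminf_sum)
  have y: "y i \<in> E i" for i
  proof -
    have "(\<lambda>m. \<Sum>j<m. ?c (a j) i) \<longlonglongrightarrow> y i"
      using summable_LIMSEQ[OF summc] by (simp add: y_def)
    moreover have "(\<Sum>j<m. ?c (a j) i) \<in> E i" for m
      by (intro subspace_sum fdd_summand(2) fdd_expansion(1) E)
    ultimately show ?thesis
      by (metis closed_sequentially[OF fdd_summand(1)[OF E]])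
  qed
  \<comment> \<open>Interchange of the limit in \<open>n\<close> with the sum over \<open>j\<close>;
    the majorant \<open>g\<close> does not depend on \<open>n\<close>, so the series converges
    uniformly in \<open>n\<close>.\<close>
  have "(\<lambda>n. \<Sum>j. ?Q n (a j)) \<longlonglongrightarrow> (\<Sum>j. a j)"
  proof (rule swap_uniform_limit'[where S = UNIV])
    show "\<forall>\<^sub>F m in sequentially. (\<lambda>n. \<Sum>j<m. ?Q n (a j)) \<longlonglongrightarrow> (\<Sum>j<m. a j)"
      by (intro always_eventually allI tendsto_sum fdd_partial_sum_LIMSEQ E)
    show "(\<lambda>m. \<Sum>j<m. a j) \<longlonglongrightarrow> (\<Sum>j. a j)"
      using a by (intro summable_LIMSEQ sums_summable)
    show "uniform_limit UNIV (\<lambda>m n. \<Sum>j<m. ?Q n (a j)) (\<lambda>n. \<Sum>j. ?Q n (a j)) sequentially"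
      using g sg by (intro Weierstrass_m_test)
  qed auto
  then have "y sums x"
    using S a by (simp add: sums_def sums_unique[OF a, symmetric])
  then have "?c x = y"
    using E y by (intro fdd_expansion_unique)
  then have "?Q n x = (\<Sum>j. ?Q n (a j))"
    using S by (simp add: fdd_partial_sum_def)
  then show ?thesis
    using g sg by (simp add: norm_suminf_le)
qed

lemma fdd_approximation:
  fixes E :: "nat \<Rightarrow> 'a::banach set"
  assumes E: "fdd E"
  shows "\<exists>K\<ge>0. \<forall>x. \<exists>a. (\<forall>n. norm (fdd_partial_sum E n a) \<le> K * norm x) \<and> norm (x - a) \<le> norm x / 2"
proof -
  let ?Q = "fdd_partial_sum E"
  define A where "A k = {x. \<forall>n. norm (?Q n x) \<le> real k}" for k
  have "x \<in> (\<Union>k. A k)" for x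
  proof -
    have "Bseq (\<lambda>n. ?Q n x)"
      using fdd_partial_sum_LIMSEQ[OF E] convergent_imp_Bseq convergent_def by blast
    then obtain C where "\<And>n. norm (?Q n x) \<le> C" by (auto simp: Bseq_def)
    moreover obtain k where "C \<le> real k" using real_arch_simple by blast
    ultimately have "x \<in> A k" unfolding A_def using order_trans by blast
    then show ?thesis by blast
  qed
  then have "(\<Union>k. closure (A k)) = UNIV"
    using closure_subset by blast
  then obtain k where "interior (closure (A k)) \<noteq> {}"
    using countable_closed_cover_interior[OF closed_closure] by metis
  then obtain z r where r: "0 < r" "ball z r \<subseteq> closure (A k)"
    unfolding mem_interior ex_in_conv[symmetric] by blast
  have small: "\<exists>a. (\<forall>n. norm (?Q n a) \<le> real k) \<and> norm (x - a) < e" if "norm x < r" "0 < e" for x e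
  proof -
    have "z + x \<in> closure (A k)" "z - x \<in> closure (A k)"
      using r that by (auto simp: dist_norm subset_iff)
    then obtain a b where ab: "a \<in> A k" "dist a (z + x) < e" "b \<in> A k" "dist b (z - x) < e"
      using \<open>0 < e\<close> unfolding closure_approachable by blast
    \<comment> \<open>Half the difference moves the approximation from the ball around
      \<open>z\<close> to the origin: \<open>z\<close> cancels, and the bound \<open>k\<close>
      survives because \<open>A k\<close> is convex and symmetric.\<close>
    define w where "w = (1/2) *\<^sub>R (a - b)"
    have "norm (?Q n w) \<le> real k" for n
    proof -
      have "?Q n w = (1/2) *\<^sub>R (?Q n a - ?Q n b)"
        using linear_fdd_partial_sum[OF E] by (simp add: w_def linear_diff linear_scale)
      moreover have "norm (?Q n a - ?Q n b) \<le> real k + real k"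
        using ab by (intro order_trans[OF norm_triangle_ineq4] add_mono) (auto simp: A_def)
      ultimately show ?thesis by simp
    qed
    moreover have "norm (x - w) < e"
    proof -
      have "x - w = (1/2) *\<^sub>R ((b - (z - x)) - (a - (z + x)))"
        by (simp add: w_def algebra_simps flip: scaleR_left.add)
      then have "norm (x - w) \<le> (norm (b - (z - x)) + norm (a - (z + x))) / 2"
        using norm_triangle_ineq4[of "b - (z - x)" "a - (z + x)"] by simp
      then show ?thesis using ab by (simp add: dist_norm)
    qed
    ultimately show ?thesis by blast
  qed
  have "\<exists>a. (\<forall>n. norm (?Q n a) \<le> (2 * real k / r) * norm x) \<and> norm (x - a) \<le> norm x / 2" for x
  proof (cases "x = 0")
    case True
    then show ?thesis
      using linear_fdd_partial_sum[OF E] by (intro exI[of _ 0]) (simp add: linear_0)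
  next
    case False
    \<comment> \<open>Rescales \<open>x\<close> to norm \<open>r / 2\<close>, inside the ball where
      \<open>small\<close> applies; scaling back turns the bound \<open>k\<close> into
      \<open>k / s = (2 * k / r) * norm x\<close>.\<close>
    define s where "s = r / (2 * norm x)"
    have s: "0 < s" using False r by (simp add: s_def)
    have "norm (s *\<^sub>R x) < r" using False r by (simp add: s_def)
    moreover have "0 < s * norm x / 2" using s False by simp
    ultimately obtain a where a: "\<And>n. norm (?Q n a) \<le> real k" "norm (s *\<^sub>R x - a) < s * norm x / 2"
      using small by blast
    let ?a = "(1 / s) *\<^sub>R a"
    have "norm (?Q n ?a) \<le> (2 * real k / r) * norm x" for n
    proof -
      have "norm (?Q n ?a) = norm (?Q n a) / s"
        using linear_fdd_partial_sum[OF E] s by (simp add: linear_scale)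
      also have "\<dots> \<le> real k / s" using a s by (simp add: divide_right_mono)
      finally show ?thesis using False r by (simp add: s_def field_simps)
    qed
    moreover have "norm (x - ?a) \<le> norm x / 2"
    proof -
      have "x - ?a = (1 / s) *\<^sub>R (s *\<^sub>R x - a)" using s by (simp add: algebra_simps)
      then have "norm (x - ?a) = norm (s *\<^sub>R x - a) / s" using s by simp
      also have "\<dots> \<le> (s * norm x / 2) / s" using a s by (intro divide_right_mono) auto
      finally show ?thesis using s by simp
    qed
    ultimately show ?thesis by blast
  qed
  then show ?thesis using r by (intro exI[of _ "2 * real k / r"]) auto
qed

lemma fdd_partial_sum_uniformly_bounded:
  fixes E :: "nat \<Rightarrow> 'a::banach set"
  assumes E: "fdd E"
  shows "\<exists>M>0. \<forall>n x. norm (fdd_partial_sum E n x) \<le> M * norm x"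
proof -
  let ?Q = "fdd_partial_sum E"
  obtain K h where K: "K \<ge> 0" and h: "\<And>x n. norm (?Q n (h x)) \<le> K * norm x"
    "\<And>x. norm (x - h x) \<le> norm x / 2"
    using fdd_approximation[OF E] by metis
  \<comment> \<open>The geometric series gives \<open>2 * K\<close>; adding 1 makes the constant
    strictly positive even if \<open>K = 0\<close>.\<close>
  have "norm (?Q n x) \<le> (2 * K + 1) * norm x" for n x
  proof -
    \<comment> \<open>The remainder after \<open>j\<close> successive approximations. It at least
      halves each time, so the approximants \<open>h (X j)\<close> telescope to
      \<open>x\<close>.\<close>
    define X where "X j = ((\<lambda>y. y - h y) ^^ j) x" for j
    have X_Suc: "X (Suc j) = X j - h (X j)" for j by (simp add: X_def)
    have X_le: "norm (X j) \<le> (1/2)^j * norm x" for j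
    proof (induction j)
      case (Suc j)
      then show ?case using h(2)[of "X j"] by (simp add: X_Suc)
    qed (simp add: X_def)
    have "(\<lambda>j. (1/2)^j * norm x) \<longlonglongrightarrow> 0"
      by (intro tendsto_mult_left_zero LIMSEQ_power_zero) simp
    then have "X \<longlonglongrightarrow> 0"
      by (rule tendsto_0_le[where K = 1]) (use X_le in auto)
    then have "(\<lambda>j. X j - X (Suc j)) sums (X 0 - 0)"
      by (rule telescope_sums')
    then have sums: "(\<lambda>j. h (X j)) sums x"
      by (simp add: X_Suc) (simp add: X_def)
    have geo: "(\<lambda>j. K * ((1/2)^j * norm x)) sums (K * (2 * norm x))"
      using geometric_sums[of "1/2 :: real"] by (intro sums_mult sums_mult2) simp
    have "norm (?Q n x) \<le> (\<Sum>j. K * ((1/2)^j * norm x))"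
    proof (rule fdd_partial_sum_bound_of_series[OF E sums])
      show "norm (?Q n (h (X j))) \<le> K * ((1/2)^j * norm x)" for n j
        using h(1)[of n "X j"] mult_left_mono[OF X_le K] order_trans by blast
    qed (use geo sums_summable in blast)
    also have "\<dots> = 2 * K * norm x" using sums_unique[OF geo] by simp
    also have "\<dots> \<le> (2 * K + 1) * norm x" by (simp add: distrib_right)
    finally show ?thesis .
  qed
  moreover have "2 * K + 1 > 0" using K by simp
  ultimately show ?thesis by blast
qed

lemma bounded_linear_fdd_partial_sum:
  fixes E :: "nat \<Rightarrow> 'a::banach set"
  assumes "fdd E"
  shows "bounded_linear (fdd_partial_sum E n)"
proof -
  obtain M where "\<And>n x. norm (fdd_partial_sum E n x) \<le> M * norm x"
    using fdd_partial_sum_uniformly_bounded[OF assms] by blast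
  then show ?thesis
    using linear_fdd_partial_sum[OF assms, of n]
    by (intro bounded_linear_intro[where K = M]) (simp_all add: linear_add linear_scale mult.commute)
qed

section \<open>The adjoint projections\<close>

lemma fdd_dual_proj_apply:
  fixes E :: "nat \<Rightarrow> 'a::banach set"
  assumes "fdd E"
  shows "fdd_dual_proj E n f x = f (fdd_partial_sum E n x)"
  using bounded_linear_fdd_partial_sum[OF assms]
  by (simp add: fdd_dual_proj_def bounded_linear_Blinfun_apply)

lemma fdd_dual_proj_diff:
  "fdd_dual_proj E n (f - g) = fdd_dual_proj E n f - fdd_dual_proj E n g"
  by (rule blinfun_eqI) (simp add: fdd_dual_proj_def blinfun.diff_left)

lemma fdd_dual_proj_add:
  "fdd_dual_proj E n (f + g) = fdd_dual_proj E n f + fdd_dual_proj E n g"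
  by (rule blinfun_eqI) (simp add: fdd_dual_proj_def blinfun.add_left)

lemma fdd_dual_proj_scaleR:
  "fdd_dual_proj E n (r *\<^sub>R f) = r *\<^sub>R fdd_dual_proj E n f"
  by (rule blinfun_eqI) (simp add: fdd_dual_proj_def blinfun.scaleR_left)

lemma fdd_dual_proj_uniformly_bounded:
  fixes E :: "nat \<Rightarrow> 'a::banach set"
  assumes E: "fdd E"
  shows "\<exists>M>0. \<forall>n f. norm (fdd_dual_proj E n f) \<le> M * norm f"
proof -
  obtain M where M: "M > 0" "\<And>n x. norm (fdd_partial_sum E n x) \<le> M * norm x"
    using fdd_partial_sum_uniformly_bounded[OF E] by blast
  have "norm (fdd_dual_proj E n f) \<le> M * norm f" for n f
  proof (rule norm_blinfun_bound)
    fix x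
    have "norm (fdd_dual_proj E n f x) \<le> norm f * norm (fdd_partial_sum E n x)"
      unfolding fdd_dual_proj_apply[OF E] by (rule norm_blinfun)
    also have "\<dots> \<le> norm f * (M * norm x)"
      by (intro mult_left_mono M) auto
    finally show "norm (fdd_dual_proj E n f x) \<le> M * norm f * norm x"
      by (simp add: mult_ac)
  qed (use M in auto)
  then show ?thesis using M by blast
qed

text \<open>Such an \<open>f\<close> sees only the coordinate in \<open>E k\<close>, so its values
  on the partial sums of \<open>x\<close> are constant once summand \<open>k\<close> is included.
  Since the first \<open>n\<close> summands are those with index below \<open>n\<close>, this means
  \<open>k < n\<close>.\<close>

lemma fdd_dual_proj_eq_self:
  fixes E :: "nat \<Rightarrow> 'a::banach set"
  assumes E: "fdd E" and f: "f \<in> fdd_dual E k" and n: "k < n"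
  shows "fdd_dual_proj E n f = f"
proof (rule blinfun_eqI)
  fix x
  have part: "f (fdd_partial_sum E m x) = f (fdd_expansion E x k)" if "k < m" for m
  proof -
    have "f (fdd_partial_sum E m x) = (\<Sum>i<m. f (fdd_expansion E x i))"
      by (simp add: fdd_partial_sum_def blinfun.sum_right)
    also have "\<dots> = (\<Sum>i\<in>{k}. f (fdd_expansion E x i))"
      using that f fdd_expansion(1)[OF E]
      by (intro sum.mono_neutral_right) (auto simp: fdd_dual_def)
    finally show ?thesis by simp
  qed
  have "(\<lambda>m. f (fdd_partial_sum E m x)) \<longlonglongrightarrow> f x"
    by (intro tendsto_intros fdd_partial_sum_LIMSEQ E)
  moreover have "(\<lambda>m. f (fdd_partial_sum E m x)) \<longlonglongrightarrow> f (fdd_expansion E x k)"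
    using part by (intro tendsto_eventually) (auto simp: eventually_at_top_dense)
  ultimately have "f x = f (fdd_expansion E x k)"
    by (rule LIMSEQ_unique)
  then show "fdd_dual_proj E n f x = f x"
    using part[OF n] by (simp add: fdd_dual_proj_apply[OF E])
qed

lemma fdd_dual_proj_eventually_eq_self:
  fixes E :: "nat \<Rightarrow> 'a::banach set"
  assumes E: "fdd E" and f: "f \<in> span (\<Union>n. fdd_dual E n)"
  shows "\<forall>\<^sub>F n in sequentially. fdd_dual_proj E n f = f"
  using f
proof (induction rule: span_induct_alt)
  case base
  then show ?case
    using fdd_dual_proj_scaleR[of E _ 0 0] by simp
next
  case (step c g h)
  then obtain k where "g \<in> fdd_dual E k" by blast
  then have "\<forall>\<^sub>F n in sequentially. fdd_dual_proj E n g = g"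
    using fdd_dual_proj_eq_self[OF E] by (auto simp: eventually_at_top_dense)
  with step.IH show ?case
    by eventually_elim (simp add: fdd_dual_proj_add fdd_dual_proj_scaleR)
qed

text \<open>Here the density in \<open>shrinking_fdd\<close> enters: convergence is trivial on the
  dense span and passes to its closure because the projections are uniformly bounded.\<close>

lemma fdd_dual_proj_LIMSEQ:
  fixes E :: "nat \<Rightarrow> 'a::banach set"
  assumes E: "shrinking_fdd E"
  shows "(\<lambda>n. fdd_dual_proj E n f) \<longlonglongrightarrow> f"
proof (rule tendstoI)
  fix e :: real assume e: "0 < e"
  have fdd: "fdd E" and dense: "closure (span (\<Union>n. fdd_dual E n)) = UNIV"
    using E by (auto simp: shrinking_fdd_def)
  obtain M where M: "M > 0" "\<And>n f. norm (fdd_dual_proj E n f) \<le> M * norm f"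
    using fdd_dual_proj_uniformly_bounded[OF fdd] by blast
  have "f \<in> closure (span (\<Union>n. fdd_dual E n))" using dense by simp
  moreover have "0 < e / (M + 1)" using M e by simp
  ultimately obtain g where g: "g \<in> span (\<Union>n. fdd_dual E n)" "dist g f < e / (M + 1)"
    unfolding closure_approachable by blast
  show "\<forall>\<^sub>F n in sequentially. dist (fdd_dual_proj E n f) f < e"
    using fdd_dual_proj_eventually_eq_self[OF fdd g(1)]
  proof eventually_elim
    case (elim n)
    then have eq: "fdd_dual_proj E n f - f = fdd_dual_proj E n (f - g) - (f - g)"
      by (simp add: fdd_dual_proj_diff)
    have "norm (fdd_dual_proj E n f - f) \<le> M * norm (f - g) + norm (f - g)"
      unfolding eq
      using M(2)[of n "f - g"] norm_triangle_ineq4[of "fdd_dual_proj E n (f - g)" "f - g"] by linarith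
    also have "\<dots> = (M + 1) * norm (f - g)" by (simp add: algebra_simps)
    also have "\<dots> < e"
      using g(2) M(1) by (simp add: dist_norm norm_minus_commute field_simps)
    finally show ?case by (simp add: dist_norm)
  qed
qed

section \<open>Weak*-to-norm continuity of the adjoint projections\<close>

lemma fdd_partial_sum_range:
  assumes "fdd E"
  shows "\<exists>D. finite D \<and> (\<forall>x. fdd_partial_sum E n x \<in> span D)"
proof -
  obtain B where B: "\<And>i. finite (B i)" "\<And>i. E i = span (B i)"
    using assms unfolding fdd_def finite_dim_subspace_def by metis
  have "fdd_partial_sum E n x \<in> span (\<Union>i<n. B i)" for x
    unfolding fdd_partial_sum_def
  proof (intro span_sum)
    fix i assume "i \<in> {..<n}"
    then have "span (B i) \<subseteq> span (\<Union>i<n. B i)" by (intro span_mono) auto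
    then show "fdd_expansion E x i \<in> span (\<Union>i<n. B i)"
      using fdd_expansion(1)[OF assms] B(2) by blast
  qed
  then show ?thesis using B(1) by (intro exI[of _ "\<Union>i<n. B i"]) auto
qed

text \<open>The range of the partial sum projection lies in the span of a finite \<open>D\<close>,
  so the values of \<open>g - f\<close> on \<open>D\<close> control the norm of its projection, and
  closeness on \<open>D\<close> is a basic weak* open condition.\<close>

lemma weak_star_neighbourhood_proj:
  fixes E :: "nat \<Rightarrow> 'a::banach set"
  assumes E: "fdd E" and e: "0 < e"
  shows "\<exists>V. openin weak_star_topology V \<and> f \<in> V \<and> (\<forall>g\<in>V. norm (fdd_dual_proj E n (g - f)) \<le> e)"
proof -
  obtain M where M: "M > 0" "\<And>n x. norm (fdd_partial_sum E n x) \<le> M * norm x"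
    using fdd_partial_sum_uniformly_bounded[OF E] by blast
  obtain D where D: "finite D" "\<And>x. fdd_partial_sum E n x \<in> span D"
    using fdd_partial_sum_range[OF E] by blast
  obtain K where K: "K \<ge> 0"
    "\<And>(h :: 'a \<Rightarrow>\<^sub>L real) x. x \<in> span D \<Longrightarrow> \<bar>h x\<bar> \<le> K * norm x * (\<Sum>b\<in>D. \<bar>h b\<bar>)"
    using functional_bound_on_span[OF D(1)] by blast
  \<comment> \<open>Chosen to give \<open>K * M * card D * s \<le> e\<close>; the added 1 keeps the
    denominator positive.\<close>
  define s where "s = e / (K * M * real (card D) + 1)"
  have KM: "0 \<le> K * M * real (card D)" using K M by simp
  then have s: "0 < s" using e by (simp add: s_def)
  define V where "V = {g :: 'a \<Rightarrow>\<^sub>L real. \<forall>b\<in>D. g b \<in> ball (f b) s}"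
  have "openin weak_star_topology V"
    unfolding V_def by (rule strong_operator_topology_basis[OF D(1)]) simp
  moreover have "f \<in> V" using s by (simp add: V_def)
  moreover have "norm (fdd_dual_proj E n (g - f)) \<le> e" if g: "g \<in> V" for g
  proof (rule norm_blinfun_bound)
    fix x
    let ?h = "g - f"
    have "(\<Sum>b\<in>D. \<bar>?h b\<bar>) \<le> (\<Sum>b\<in>D. s)"
      using g by (intro sum_mono) (auto simp: V_def dist_norm blinfun.diff_left abs_minus_commute less_imp_le)
    then have sum: "(\<Sum>b\<in>D. \<bar>?h b\<bar>) \<le> real (card D) * s" by simp
    have "norm (fdd_dual_proj E n ?h x) = \<bar>?h (fdd_partial_sum E n x)\<bar>"
      by (simp add: fdd_dual_proj_apply[OF E])
    also have "\<dots> \<le> K * norm (fdd_partial_sum E n x) * (\<Sum>b\<in>D. \<bar>?h b\<bar>)"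
      by (rule K(2)[OF D(2)])
    also have "\<dots> \<le> K * (M * norm x) * (real (card D) * s)"
      using K(1) M sum by (intro mult_mono) (auto simp: sum_nonneg intro: less_imp_le)
    also have "\<dots> = (K * M * real (card D) * s) * norm x" by simp
    also have "\<dots> \<le> e * norm x"
    proof (rule mult_right_mono)
      have "K * M * real (card D) * s \<le> (K * M * real (card D) + 1) * s" using s by (simp add: distrib_right)
      also have "\<dots> = e" using KM by (simp add: s_def)
      finally show "K * M * real (card D) * s \<le> e" .
    qed simp
    finally show "norm (fdd_dual_proj E n ?h x) \<le> e * norm x" .
  qed (use e in simp)
  ultimately show ?thesis by blast
qed

section \<open>The Szlenk derivation of the dual ball\<close>

text \<open>Otherwise \<open>K \<inter> V\<close> would lie in the closed ball of radius
  \<open>\<epsilon> / 2\<close> around \<open>f\<close> and have diameter at most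
  \<open>\<epsilon>\<close>.\<close>

lemma szlenk_derivation_far_point:
  assumes f: "f \<in> szlenk_derivation \<epsilon> K" and V: "openin weak_star_topology V" "f \<in> V"
  shows "\<exists>g\<in>K \<inter> V. \<epsilon> / 2 < norm (g - f)"
proof (rule ccontr)
  assume neg: "\<not> ?thesis"
  have "f \<in> K" "\<epsilon> < diameter (K \<inter> V)"
    using f V by (auto simp: szlenk_derivation_def)
  moreover have "diameter (K \<inter> V) \<le> \<epsilon>"
  proof (rule diameter_le)
    show "K \<inter> V \<noteq> {} \<or> 0 \<le> \<epsilon>" using \<open>f \<in> K\<close> V by blast
    fix g h assume "g \<in> K \<inter> V" "h \<in> K \<inter> V"
    then have "norm (g - f) \<le> \<epsilon> / 2" "norm (h - f) \<le> \<epsilon> / 2" using neg by force+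
    then show "norm (g - h) \<le> \<epsilon>"
      using norm_triangle_ineq4[of "g - f" "h - f"] by simp
  qed
  ultimately show False by simp
qed

text \<open>With \<open>n\<close> fixed so that \<open>P\<^sub>n f\<close> is within
  \<open>e / 2\<close> of \<open>f\<close>, a far point \<open>g\<close> in a weak* neighbourhood
  adapted to \<open>n\<close> has \<open>P\<^sub>n g\<close> within \<open>e\<close> of
  \<open>f\<close>. Both bounds are then triangle inequalities; \<open>g\<close> depends on
  \<open>n\<close>.\<close>

lemma szlenk_derivation_point_splitting:
  fixes E :: "nat \<Rightarrow> 'a::banach set" and f :: "'a \<Rightarrow>\<^sub>L real"
  assumes E: "shrinking_fdd E" and f: "f \<in> szlenk_derivation \<epsilon> (cball 0 1)" and e: "0 < e"
  shows "\<forall>\<^sub>F n in sequentially. \<exists>g. norm g \<le> 1 \<and> norm f - e \<le> norm (fdd_dual_proj E n g) \<and>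
    \<epsilon> / 2 - e \<le> norm (g - fdd_dual_proj E n g)"
proof -
  have fdd: "fdd E" using E by (simp add: shrinking_fdd_def)
  have "\<forall>\<^sub>F n in sequentially. dist (fdd_dual_proj E n f) f < e / 2"
    using fdd_dual_proj_LIMSEQ[OF E] e by (intro tendstoD) auto
  then show ?thesis
  proof eventually_elim
    case (elim n)
    let ?P = "fdd_dual_proj E n"
    obtain V where V: "openin weak_star_topology V" "f \<in> V" "\<And>g. g \<in> V \<Longrightarrow> norm (?P (g - f)) \<le> e / 2"
      using weak_star_neighbourhood_proj[OF fdd, of "e / 2" f n] e by auto
    obtain g where g: "norm g \<le> 1" "g \<in> V" "\<epsilon> / 2 < norm (g - f)"
      using szlenk_derivation_far_point[OF f V(1,2)] by auto
    have 1: "norm (?P g - ?P f) \<le> e / 2" using V(3)[OF g(2)] by (simp add: fdd_dual_proj_diff)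
    have 2: "norm (?P f - f) < e / 2" using elim by (simp add: dist_norm)
    have "norm f - e \<le> norm (?P g)"
      using 1 2 norm_triangle_ineq4[of "?P f" "?P f - f"] norm_triangle_ineq4[of "?P g" "?P g - ?P f"]
      by simp
    moreover have "\<epsilon> / 2 - e \<le> norm (g - ?P g)"
      using 1 2 g(3) norm_triangle_ineq[of "g - ?P f" "?P f - f"]
        norm_triangle_ineq[of "g - ?P g" "?P g - ?P f"]
      by simp
    ultimately show ?case using g(1) by blast
  qed
qed

text \<open>Infinite dimension forces a nontrivial summand \<open>E m\<close> with
  \<open>m \<ge> n\<close>. A nonzero functional on it, composed with the \<open>m\<close>-th
  coordinate map and normalised, vanishes on the first \<open>n\<close> summands.\<close>

lemma exists_functional_killed_by_proj:
  fixes E :: "nat \<Rightarrow> 'a::banach set"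
  assumes E: "fdd E" and inf: "\<not> finite_dim_subspace (UNIV :: 'a set)"
  shows "\<exists>g :: 'a \<Rightarrow>\<^sub>L real. norm g = 1 \<and> fdd_dual_proj E n g = 0"
proof -
  let ?Q = "fdd_partial_sum E" and ?e = "fdd_expansion E"
  have "\<exists>m\<ge>n. \<not> E m \<subseteq> {0}"
  proof (rule ccontr)
    assume "\<not> ?thesis"
    then have triv: "E m \<subseteq> {0}" if "m \<ge> n" for m using that by blast
    have "?Q n x = x" for x
    proof -
      have "?e x sums (\<Sum>i<n. ?e x i)"
      proof (rule sums_finite)
        show "?e x i = 0" if "i \<notin> {..<n}" for i
          using triv[of i] fdd_expansion(1)[OF E, of x i] that by auto
      qed simp
      then show ?thesis
        using fdd_expansion(2)[OF E, of x] sums_unique2 unfolding fdd_partial_sum_def by blast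
    qed
    then obtain D :: "'a set" where "finite D" "\<And>x. x \<in> span D"
      using fdd_partial_sum_range[OF E, of n] by auto
    then show False using inf unfolding finite_dim_subspace_def by blast
  qed
  then obtain m where m: "m \<ge> n" "\<not> E m \<subseteq> {0}" by blast
  obtain B where B: "finite B" "E m = span B"
    using E unfolding fdd_def finite_dim_subspace_def by blast
  obtain c b K where b: "b \<in> E m" "c b \<noteq> (0::real)"
    and K: "\<And>x. x \<in> E m \<Longrightarrow> \<bar>c x\<bar> \<le> K * norm x"
    and add: "\<And>x y. x \<in> E m \<Longrightarrow> y \<in> E m \<Longrightarrow> c (x + y) = c x + c y"
    and scale: "\<And>r x. x \<in> E m \<Longrightarrow> c (r *\<^sub>R x) = r * c x"
    using exists_nonzero_functional_on_span[OF B(1) m(2)[unfolded B(2)]] unfolding B(2)[symmetric] by blast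
  obtain M where M: "M > 0" "\<And>n x. norm (?Q n x) \<le> M * norm x"
    using fdd_partial_sum_uniformly_bounded[OF E] by blast
  define h where "h x = c (?e x m)" for x
  have e_eq: "?e x m = ?Q (Suc m) x - ?Q m x" for x by (simp add: fdd_partial_sum_def)
  have "bounded_linear h"
  proof (rule bounded_linear_intro)
    show "h (x + y) = h x + h y" for x y
      using add fdd_expansion(1)[OF E] by (simp add: h_def fdd_expansion_add[OF E])
    show "h (r *\<^sub>R x) = r *\<^sub>R h x" for r x
      using scale fdd_expansion(1)[OF E] by (simp add: h_def fdd_expansion_scaleR[OF E])
    show "norm (h x) \<le> norm x * (\<bar>K\<bar> * (2 * M))" for x
    proof -
      have "norm (?e x m) \<le> 2 * M * norm x"
        unfolding e_eq using norm_triangle_ineq4[of "?Q (Suc m) x" "?Q m x"] M(2)[of "Suc m" x] M(2)[of m x]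
        by simp
      moreover have "\<bar>h x\<bar> \<le> \<bar>K\<bar> * norm (?e x m)"
        using K[OF fdd_expansion(1)[OF E]] unfolding h_def
        by (meson abs_ge_self mult_right_mono norm_ge_zero order_trans)
      ultimately have "\<bar>h x\<bar> \<le> \<bar>K\<bar> * (2 * M * norm x)"
        by (meson abs_ge_zero mult_left_mono order_trans)
      then show ?thesis by (simp add: mult_ac)
    qed
  qed
  then have h: "blinfun_apply (Blinfun h) = h" by (rule bounded_linear_Blinfun_apply)
  have single: "?e x = (\<lambda>i. if i = k then x else 0)" if "x \<in> E k" for x k
    using that subspace_0[OF fdd_summand(2)[OF E]] by (intro fdd_expansion_unique E) (auto intro: sums_single)
  have "h b \<noteq> 0" using b single[OF b(1)] by (simp add: h_def)
  then have nz: "Blinfun h \<noteq> 0" by (metis h zero_blinfun.rep_eq)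
  have kill: "fdd_dual_proj E n (Blinfun h) = 0"
  proof (rule blinfun_eqI)
    fix x
    \<comment> \<open>The expansion of the partial sum is the truncated expansion of
      \<open>x\<close>; its \<open>m\<close>-th entry is 0 because \<open>m \<ge> n\<close>.\<close>
    let ?c = "\<lambda>i. if i < n then ?e x i else 0"
    have "?c sums (\<Sum>i<n. ?c i)" by (rule sums_finite) auto
    then have "?c sums ?Q n x" by (simp add: fdd_partial_sum_def)
    then have "?e (?Q n x) = ?c"
      using fdd_expansion(1)[OF E] subspace_0[OF fdd_summand(2)[OF E]]
      by (intro fdd_expansion_unique E) auto
    moreover have "c 0 = 0" using scale[OF b(1), of 0] by simp
    ultimately show "fdd_dual_proj E n (Blinfun h) x = blinfun_apply 0 x"
      using m(1) by (simp add: fdd_dual_proj_apply[OF E] h h_def)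
  qed
  show ?thesis
    using nz kill
    by (intro exI[of _ "(1 / norm (Blinfun h)) *\<^sub>R Blinfun h"]) (simp add: fdd_dual_proj_scaleR)
qed

section \<open>The estimate\<close>

text \<open>A continuous injection on an interval is strictly monotone. A decreasing one would be
  bounded by \<open>f 0\<close> and miss \<open>f 0 + 1\<close>; an increasing one can attain 0 only
  at 0.\<close>

lemma continuous_bijection_nonneg:
  fixes f :: "real \<Rightarrow> real"
  assumes "continuous_on {0..} f" "bij_betw f {0..} {0..}"
  shows "strict_mono_on {0..} f" "f 0 = 0"
proof -
  have inj: "inj_on f {0..}" and im: "f ` {0..} = {0..}" using assms by (auto simp: bij_betw_def)
  have "strict_mono_on {0..} f \<or> strict_antimono_on {0..} f"
    using injective_eq_monotone_map[of "{0..}" f] assms(1) inj by (simp add: is_interval_ci)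
  moreover have "\<not> strict_antimono_on {0..} f"
  proof
    assume anti: "strict_antimono_on {0..} f"
    have "f 0 \<ge> 0" using im by auto
    then have "f 0 + 1 \<in> f ` {0..}" using im by simp
    then obtain t where "t \<ge> 0" "f t = f 0 + 1" by auto
    moreover have "f t \<le> f 0"
      using monotone_onD[OF anti, of 0 t] \<open>t \<ge> 0\<close> by (cases "t = 0") auto
    ultimately show False by simp
  qed
  ultimately show mono: "strict_mono_on {0..} f" by blast
  have "0 \<in> f ` {0..}" using im by simp
  then obtain t where t: "t \<ge> 0" "f t = 0" by auto
  have "f 0 \<ge> 0" using im by auto
  then show "f 0 = 0"
    using strict_mono_onD[OF mono, of 0 t] t by (cases "t = 0") auto
qed

lemma continuous_bijection_nonneg_mono:
  fixes f :: "real \<Rightarrow> real"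
  assumes "continuous_on {0..} f" "bij_betw f {0..} {0..}" "0 \<le> s" "s \<le> t"
  shows "f s \<le> f t"
  using strict_mono_onD[OF continuous_bijection_nonneg(1)[OF assms(1,2)], of s t] assms(3,4)
  by (cases "s = t") auto

text \<open>Lets the error \<open>e\<close> tend to 0 in the main estimate. The truncation by
  \<open>max 0\<close> keeps arguments in the half-line, the only place where \<open>f\<close> is
  controlled.\<close>

lemma continuous_nonneg_tendsto_truncated:
  fixes f :: "real \<Rightarrow> real"
  assumes "continuous_on {0..} f" "0 \<le> a" "C \<noteq> 0"
  shows "((\<lambda>e. f (max 0 (a - e / C))) \<longlongrightarrow> f a) (at_right 0)"
proof -
  have "continuous_on UNIV (\<lambda>e. max 0 (a - e / C))"
    using assms(3) by (intro continuous_intros) auto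
  then have "continuous_on UNIV (\<lambda>e. f (max 0 (a - e / C)))"
    by (intro continuous_on_compose2[OF assms(1)]) auto
  then have "((\<lambda>e. f (max 0 (a - e / C))) \<longlongrightarrow> f (max 0 (a - 0 / C))) (at 0)"
    unfolding continuous_on_def by (metis UNIV_I)
  then show ?thesis
    using assms(2) by (simp add: filterlim_at_split max_absorb2)
qed

text \<open>\<open>J\<close> stands for the inclusion of the dual in Z. The threshold for
  \<open>n\<close> in the renorming hypothesis is uniform in \<open>f\<close>, as the functional it
  is applied to is chosen after \<open>n\<close>. The conclusion has two parts because
  \<open>inv_into\<close> is meaningful only on the range of \<open>phi\<close>, and in finite
  dimension its argument may be negative.\<close>

theorem theorem2:
  fixes E :: "nat \<Rightarrow> 'a::banach set"
    and J :: "('a \<Rightarrow>\<^sub>L real) \<Rightarrow> 'z::banach"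
    and C1 C2 \<epsilon> :: real
    and phi psi chi :: "real \<Rightarrow> real"
  assumes "shrinking_fdd E"
    and "linear J" and "inj J"
    and "0 < C1" and "0 < C2"
    and "\<And>f. C1 * norm (J f) \<le> norm f"
    and "\<And>f. norm f \<le> C2 * norm (J f)"
    and "continuous_on {0..} phi" and "bij_betw phi {0..} {0..}"
    and "continuous_on {0..} psi" and "bij_betw psi {0..} {0..}"
    and "continuous_on {0..} chi" and "bij_betw chi {0..} {0..}"
    and "\<forall>\<^sub>F n in sequentially. \<forall>f.
      phi (norm (J (fdd_dual_proj E n f))) + psi (norm (J (f - fdd_dual_proj E n f))) \<le> chi (norm (J f))"
    and "0 < \<epsilon>" and "\<epsilon> < 2"
  shows "(\<not> finite_dim_subspace (UNIV :: 'a set) \<longrightarrow> 0 \<le> chi (1 / C1) - psi (\<epsilon> / (2 * C2))) \<and>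
    (0 \<le> chi (1 / C1) - psi (\<epsilon> / (2 * C2)) \<longrightarrow>
      szlenk_radius TYPE('a) \<epsilon> \<le> C2 * inv_into {0..} phi (chi (1 / C1) - psi (\<epsilon> / (2 * C2))))"
proof -
  let ?P = "fdd_dual_proj E" and ?c = "chi (1 / C1) - psi (\<epsilon> / (2 * C2))"
  note phi = assms(8,9) and psi = assms(10,11) and chi = assms(12,13)
  have fdd: "fdd E" using assms(1) by (simp add: shrinking_fdd_def)
  have norm_J: "norm f / C2 \<le> norm (J f)" for f
    using assms(5) assms(7)[of f] by (simp add: field_simps)
  have chi_le: "chi (norm (J g)) \<le> chi (1 / C1)" if "norm g \<le> 1" for g
  proof (rule continuous_bijection_nonneg_mono[OF chi])
    have "C1 * norm (J g) \<le> 1" using assms(6)[of g] that by simp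
    then show "norm (J g) \<le> 1 / C1" using assms(4) by (simp add: field_simps)
  qed simp
  have main: "phi (norm f / C2) \<le> ?c" if f: "f \<in> szlenk_derivation \<epsilon> (cball 0 1)"
    for f :: "'a \<Rightarrow>\<^sub>L real"
  proof -
    have bound: "phi (max 0 (norm f / C2 - e / C2)) + psi (max 0 (\<epsilon> / (2 * C2) - e / C2)) \<le> chi (1 / C1)"
      if e: "0 < e" for e
    proof -
      have "\<forall>\<^sub>F n in sequentially. phi (max 0 (norm f / C2 - e / C2)) +
          psi (max 0 (\<epsilon> / (2 * C2) - e / C2)) \<le> chi (1 / C1)"
        using assms(14) szlenk_derivation_point_splitting[OF assms(1) f e]
      proof eventually_elim
        case (elim n)
        then obtain g where g: "norm g \<le> 1" "norm f - e \<le> norm (?P n g)"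
          "\<epsilon> / 2 - e \<le> norm (g - ?P n g)" by blast
        have "(norm f - e) / C2 \<le> norm (?P n g) / C2"
          using g assms(5) by (intro divide_right_mono) auto
        then have "norm f / C2 - e / C2 \<le> norm (J (?P n g))"
          using norm_J[of "?P n g"] by (simp add: diff_divide_distrib)
        then have 1: "phi (max 0 (norm f / C2 - e / C2)) \<le> phi (norm (J (?P n g)))"
          by (intro continuous_bijection_nonneg_mono[OF phi]) auto
        have "(\<epsilon> / 2 - e) / C2 \<le> norm (g - ?P n g) / C2"
          using g assms(5) by (intro divide_right_mono) auto
        then have "\<epsilon> / (2 * C2) - e / C2 \<le> norm (J (g - ?P n g))"
          using norm_J[of "g - ?P n g"] by (simp add: diff_divide_distrib)
        then have 2: "psi (max 0 (\<epsilon> / (2 * C2) - e / C2)) \<le> psi (norm (J (g - ?P n g)))"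
          by (intro continuous_bijection_nonneg_mono[OF psi]) auto
        show ?case
          using 1 2 elim(1)[rule_format, of g] chi_le[OF g(1)] by linarith
      qed
      \<comment> \<open>The inequality no longer mentions \<open>n\<close>, so holding eventually
        means holding outright.\<close>
      then show ?thesis by simp
    qed
    have "phi (norm f / C2) + psi (\<epsilon> / (2 * C2)) \<le> chi (1 / C1)"
    proof (rule tendsto_upperbound)
      show "((\<lambda>e. phi (max 0 (norm f / C2 - e / C2)) + psi (max 0 (\<epsilon> / (2 * C2) - e / C2)))
          \<longlongrightarrow> phi (norm f / C2) + psi (\<epsilon> / (2 * C2))) (at_right 0)"
        using assms(5,15)
        by (intro tendsto_add continuous_nonneg_tendsto_truncated phi(1) psi(1)) auto
      show "\<forall>\<^sub>F e in at_right 0. phi (max 0 (norm f / C2 - e / C2)) +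
          psi (max 0 (\<epsilon> / (2 * C2) - e / C2)) \<le> chi (1 / C1)"
        using bound by (simp add: eventually_at_filter)
    qed simp
    then show ?thesis by simp
  qed
  have "0 \<le> ?c" if inf: "\<not> finite_dim_subspace (UNIV :: 'a set)"
  proof -
    obtain n where n: "\<And>f. phi (norm (J (?P n f))) + psi (norm (J (f - ?P n f))) \<le> chi (norm (J f))"
      using assms(14) by (auto simp: eventually_sequentially)
    obtain g where g: "norm g = 1" "?P n g = 0"
      using exists_functional_killed_by_proj[OF fdd inf] by blast
    \<comment> \<open>Here \<open>\<epsilon> < 2\<close> enters: a functional of norm one has
      \<open>J\<close>-norm at least \<open>1 / C2\<close>.\<close>
    have "\<epsilon> / (2 * C2) \<le> 1 / C2" using assms(5,16) by (simp add: field_simps)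
    also have "\<dots> \<le> norm (J g)" using norm_J[of g] g by simp
    finally have "psi (\<epsilon> / (2 * C2)) \<le> psi (norm (J g))"
      using assms(5,15) by (intro continuous_bijection_nonneg_mono[OF psi]) auto
    moreover have "0 \<le> phi (norm (J (?P n g)))"
      using bij_betwE[OF phi(2)] by simp
    ultimately show ?thesis
      using n[of g] g chi_le[of g] by simp
  qed
  moreover have "szlenk_radius TYPE('a) \<epsilon> \<le> C2 * inv_into {0..} phi ?c" if c: "0 \<le> ?c"
  proof (rule field_le_epsilon)
    \<comment> \<open>The slack \<open>e\<close> is needed because \<open>szlenk_radius\<close>
      ranges over strictly positive radii, while \<open>t\<close> may be 0.\<close>
    fix e :: real assume e: "0 < e"
    define t where "t = inv_into {0..} phi ?c"
    have "?c \<in> phi ` {0..}" using c phi(2) by (simp add: bij_betw_def)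
    then have t: "0 \<le> t" "phi t = ?c"
      unfolding t_def using inv_into_into[of ?c phi "{0..}"] f_inv_into_f[of ?c phi "{0..}"] by auto
    have "norm f \<le> C2 * t" if f: "f \<in> szlenk_derivation \<epsilon> (cball 0 1)" for f :: "'a \<Rightarrow>\<^sub>L real"
    proof (rule ccontr)
      assume "\<not> ?thesis"
      then have "t < norm f / C2" using assms(5) by (simp add: field_simps)
      then have "phi t < phi (norm f / C2)"
        using strict_mono_onD[OF continuous_bijection_nonneg(1)[OF phi], of t "norm f / C2"] t(1) by simp
      then show False using main[OF f] t by simp
    qed
    then have "szlenk_derivation \<epsilon> (cball (0 :: 'a \<Rightarrow>\<^sub>L real) 1) \<subseteq> cball 0 (C2 * t + e)"
      using e by fastforce
    moreover have "0 < C2 * t + e" using e t assms(5) by (simp add: add_nonneg_pos)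
    ultimately show "szlenk_radius TYPE('a) \<epsilon> \<le> C2 * inv_into {0..} phi ?c + e"
      unfolding szlenk_radius_def t_def[symmetric]
      by (intro cInf_lower) (auto intro: bdd_belowI[of _ 0] less_imp_le)
  qed
  ultimately show ?thesis by blast
qed

end
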